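(* For all $p,q\in\mathbb{R}_n[t]$ and all $\xi\in\mathbb{R}$, $$\langle p(s)\,q(t),\,K_n(\xi,st)\rangle_{\mathrm{ap}}=\sum_{k=0}^n\binom nk\,\beta_n(p)_k\,\beta_n(q)_k\,\xi^k=(p\boxtimes_n q)(\xi),$$ where $K_n(\xi,st)=(1+\xi st)^n$.
   Context: $\mathbb{R}_n[t]$ is the space of real polynomials of degree at most $n$. For $p(t)=\sum_{k=0}^n p_kt^k$ set $\beta_n(p)_k:=p_k/\binom nk$. $\mathbb{R}_n[s,t]$ is the space of real polynomials of degree at most $n$ in each of $s$ and $t$, equipped with the tensor product apolar inner product (in the variables $s,t$, with $\xi$ a parameter), the bilinear form given on monomials by $$\langle s^it^j,s^kt^\ell\rangle_{\mathrm{ap}}=\binom nk^{-1}\binom n\ell^{-1}\delta_{ik}\,\delta_{j\ell}.$$ The finite free multiplicative convolution is $p\boxtimes_n q:=\sum_{k=0}^n\binom nk\beta_n(p)_k\,\beta_n(q)_k\,t^k$. *)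

theory Defs
  imports "HOL-Computational_Algebra.Polynomial"
begin

text \<open>
  A bivariate polynomial in \<open>s, t\<close> is an element of \<open>\<real>[t][s]\<close>, i.e. of type
  \<^typ>\<open>real poly poly\<close>: the outer variable is \<open>s\<close>, the inner one is \<open>t\<close>, and the coefficient
  of \<open>s^i t^j\<close> in \<open>P\<close> is \<open>coeff (coeff P i) j\<close>.
\<close>

definition var_s :: "real poly poly" where
  "var_s = [:0, 1:]"

definition var_t :: "real poly poly" where
  "var_t = [:[:0, 1:]:]"

definition in_s :: "real poly \<Rightarrow> real poly poly" where
  "in_s p = map_poly (\<lambda>c. [:c:]) p"

definition in_t :: "real poly \<Rightarrow> real poly poly" where
  "in_t q = [:q:]"

definition poly_space :: "nat \<Rightarrow> real poly set" where
  "poly_space n = {p. degree p \<le> n}"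

definition poly_space2 :: "nat \<Rightarrow> real poly poly set" where
  "poly_space2 n = {P. degree P \<le> n \<and> (\<forall>i. degree (coeff P i) \<le> n)}"

definition beta :: "nat \<Rightarrow> real poly \<Rightarrow> nat \<Rightarrow> real" where
  "beta n p k = coeff p k / real (n choose k)"

definition mult_conv :: "nat \<Rightarrow> real poly \<Rightarrow> real poly \<Rightarrow> real poly" where
  "mult_conv n p q = (\<Sum>k\<le>n. monom (real (n choose k) * beta n p k * beta n q k) k)"

definition apolar_monom :: "nat \<Rightarrow> nat \<Rightarrow> nat \<Rightarrow> nat \<Rightarrow> nat \<Rightarrow> real" where
  "apolar_monom n i j k l =
     inverse (real (n choose k)) * inverse (real (n choose l)) * of_bool (i = k) * of_bool (j = l)"

text \<open>
  The bilinear extension of \<open>apolar_monom\<close> to \<open>poly_space2 n\<close>. Outside \<open>poly_space2 n\<close>, monomials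
  of degree above \<open>n\<close> in \<open>s\<close> or \<open>t\<close> are ignored.
\<close>

definition apolar :: "nat \<Rightarrow> real poly poly \<Rightarrow> real poly poly \<Rightarrow> real" where
  "apolar n P Q =
     (\<Sum>i\<le>n. \<Sum>j\<le>n. \<Sum>k\<le>n. \<Sum>l\<le>n.
        coeff (coeff P i) j * coeff (coeff Q k) l * apolar_monom n i j k l)"

definition kernel :: "nat \<Rightarrow> real \<Rightarrow> real poly poly \<Rightarrow> real poly poly" where
  "kernel n \<xi> u = (1 + smult [:\<xi>:] u) ^ n"

lemma monomial2: "var_s ^ i * var_t ^ j = monom (monom 1 j) i"
proof -
  have t: "var_t ^ j = [:monom 1 j:]"
    by (induction j) (simp_all add: var_t_def monom_Suc)
  have s: "var_s ^ i = monom 1 i"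
    unfolding var_s_def by (metis monom_altdef smult_1_left)
  show ?thesis
    by (simp add: s t smult_monom)
qed

lemma apolar_on_monomials:
  assumes "i \<le> n" "j \<le> n" "k \<le> n" "l \<le> n"
  shows "apolar n (var_s ^ i * var_t ^ j) (var_s ^ k * var_t ^ l) = apolar_monom n i j k l"
proof -
  have c: "coeff (coeff (monom (monom (1::real) j) i) a) b = of_bool (i = a) * of_bool (j = b)" for i j a b
    by auto
  have d: "(\<Sum>a\<le>n. of_bool (i = a) * f a) = f i" if "i \<le> n" for i and f :: "nat \<Rightarrow> real"
    using that by (simp add: of_bool_def if_distrib [of "\<lambda>x. x * _"] cong: if_cong)
  show ?thesis
    using assms unfolding apolar_def monomial2 c
    by (simp add: mult.assoc sum_distrib_left [symmetric] d del: sum_of_bool_mult_eq)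
qed

lemma apolar_bilinear:
  "apolar n (P + P') Q = apolar n P Q + apolar n P' Q"
  "apolar n (smult [:c:] P) Q = c * apolar n P Q"
  "apolar n P (Q + Q') = apolar n P Q + apolar n P Q'"
  "apolar n P (smult [:c:] Q) = c * apolar n P Q"
  by (simp_all add: apolar_def algebra_simps sum.distrib sum_distrib_left)

lemma product_in_poly_space2:
  assumes "p \<in> poly_space n" "q \<in> poly_space n"
  shows "in_s p * in_t q \<in> poly_space2 n"
proof -
  have "degree (in_s p) = degree p"
    unfolding in_s_def by (intro degree_map_poly) auto
  moreover have "coeff (in_s p * in_t q) i = smult (coeff p i) q" for i
    by (simp add: in_s_def in_t_def coeff_map_poly)
  ultimately show ?thesis
    using assms degree_smult_le[of _ q]
    by (auto simp: poly_space_def poly_space2_def in_t_def intro: order_trans[OF degree_smult_le])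
qed

lemma kernel_in_poly_space2: "kernel n \<xi> (var_s * var_t) \<in> poly_space2 n"
proof -
  have e: "smult [:\<xi>:] (var_s * var_t) = monom (monom \<xi> 1) 1"
    by (simp add: var_s_def var_t_def monom_Suc monom_0)
  have "kernel n \<xi> (var_s * var_t) =
      (\<Sum>k\<le>n. monom (monom (of_nat (n choose k) * \<xi> ^ k) k) k)"
    unfolding kernel_def e add.commute[of 1] binomial_ring
    by (simp add: monom_power of_nat_monom mult_monom)
  then show ?thesis
    by (auto simp: poly_space2_def coeff_sum intro!: degree_sum_le order_trans[OF degree_monom_le])
qed

end

theory Submission
  imports Defs
begin

text \<open>The monomials s^k t^l are orthogonal for the apolar form, so \<open>apolar\<close> is a
  weighted sum of products of matching coefficients (\<open>apolar_eq_diagonal_sum\<close>). By the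
  binomial theorem the kernel contains only the monomials s^k t^k, with coefficient (n choose k)
  \<xi>^k (\<open>coeff_kernel\<close>). Pairing it with p(s) q(t) therefore extracts the products
  p_k q_k; of the two inverse binomials in the weight, the kernel's binomial cancels one, and
  rewriting p_k and q_k through \<open>beta\<close> gives the coefficients of the
  convolution.\<close>

lemma coeff_in_s_times_in_t: "coeff (coeff (in_s p * in_t q) i) j = coeff p i * coeff q j"
  by (simp add: in_s_def in_t_def coeff_map_poly)

text \<open>Binomial theorem in the nested polynomial ring: \<xi>st is a single monomial there, so
  its k-th power is \<xi>^k s^k t^k.\<close>

lemma kernel_expansion:
  "kernel n \<xi> (var_s * var_t) = (\<Sum>k\<le>n. monom (monom (real (n choose k) * \<xi> ^ k) k) k)"
proof -
  have "smult [:\<xi>:] (var_s * var_t) = monom (monom \<xi> 1) 1"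
    by (simp add: var_s_def var_t_def monom_Suc monom_0)
  then show ?thesis
    unfolding kernel_def add.commute[of 1]
    by (simp add: binomial_ring monom_power of_nat_monom mult_monom)
qed

lemma coeff_kernel:
  assumes "k \<le> n"
  shows "coeff (coeff (kernel n \<xi> (var_s * var_t)) k) l =
           of_bool (k = l) * (real (n choose k) * \<xi> ^ k)"
proof -
  have "coeff (coeff (kernel n \<xi> (var_s * var_t)) k) l =
      (\<Sum>m\<le>n. if m = k then (if k = l then real (n choose k) * \<xi> ^ k else 0) else 0)"
    unfolding kernel_expansion coeff_sum by (intro sum.cong) auto
  then show ?thesis
    using assms by simp
qed

text \<open>Orthogonality of the monomials collapses the fourfold sum: for each (i, j) only (k, l) =
  (i, j) survives.\<close>

lemma apolar_eq_diagonal_sum: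
  "apolar n P Q =
     (\<Sum>k\<le>n. \<Sum>l\<le>n. coeff (coeff P k) l * coeff (coeff Q k) l / (real (n choose k) * real (n choose l)))"
proof -
  have "(\<Sum>k\<le>n. \<Sum>l\<le>n. coeff (coeff P i) j * coeff (coeff Q k) l * apolar_monom n i j k l) =
      coeff (coeff P i) j * coeff (coeff Q i) j / (real (n choose i) * real (n choose j))"
    if "i \<le> n" "j \<le> n" for i j
  proof -
    \<comment> \<open>Testing \<open>j = l\<close> outermost lets the inner sum over l collapse
      first, then the sum over k.\<close>
    have "(\<Sum>k\<le>n. \<Sum>l\<le>n. coeff (coeff P i) j * coeff (coeff Q k) l * apolar_monom n i j k l) =
        (\<Sum>k\<le>n. \<Sum>l\<le>n. if j = l then if i = k then coeff (coeff P i) j * coeff (coeff Q i) j /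
            (real (n choose i) * real (n choose j)) else 0 else 0)"
      by (intro sum.cong refl) (simp add: apolar_monom_def divide_inverse)
    then show ?thesis
      using that by simp
  qed
  then show ?thesis
    unfolding apolar_def by (intro sum.cong) auto
qed

theorem proposition2p6:
  fixes n :: nat and p q :: "real poly" and \<xi> :: real
  assumes "p \<in> poly_space n" and "q \<in> poly_space n"
  shows "apolar n (in_s p * in_t q) (kernel n \<xi> (var_s * var_t))
           = (\<Sum>k\<le>n. real (n choose k) * beta n p k * beta n q k * \<xi> ^ k)
       \<and> (\<Sum>k\<le>n. real (n choose k) * beta n p k * beta n q k * \<xi> ^ k)
           = poly (mult_conv n p q) \<xi>"
proof
  have "(\<Sum>l\<le>n. coeff (coeff (in_s p * in_t q) k) l *
          coeff (coeff (kernel n \<xi> (var_s * var_t)) k) l / (real (n choose k) * real (n choose l))) =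
      real (n choose k) * beta n p k * beta n q k * \<xi> ^ k" if "k \<le> n" for k
  proof -
    \<comment> \<open>The kernel has no term s^k t^l with l different from k, so row k of the form
      reduces to its diagonal entry.\<close>
    have "(\<Sum>l\<le>n. coeff (coeff (in_s p * in_t q) k) l *
          coeff (coeff (kernel n \<xi> (var_s * var_t)) k) l / (real (n choose k) * real (n choose l))) =
        (\<Sum>l\<le>n. if k = l then real (n choose k) * beta n p k * beta n q k * \<xi> ^ k else 0)"
      using that
      by (intro sum.cong) (auto simp: coeff_in_s_times_in_t coeff_kernel beta_def)
    then show ?thesis
      using that by simp
  qed
  then show "apolar n (in_s p * in_t q) (kernel n \<xi> (var_s * var_t))
      = (\<Sum>k\<le>n. real (n choose k) * beta n p k * beta n q k * \<xi> ^ k)"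
    unfolding apolar_eq_diagonal_sum by (intro sum.cong) auto
  show "(\<Sum>k\<le>n. real (n choose k) * beta n p k * beta n q k * \<xi> ^ k) = poly (mult_conv n p q) \<xi>"
    by (simp add: mult_conv_def poly_sum poly_monom)
qed

end
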